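(* Let $X=\{x_1,\dots,x_n\}$ be a finite set with $n\ge 1$ elements in a fixed enumeration, and let $(X,\bullet)$ be a groupoid with the orientation property. Then $(X,\bullet)$ is $j$-normal.
   Context: A groupoid $(X,\bullet)$ is a non-empty set $X$ with an arbitrary binary operation $\bullet:X\times X\to X$. It has the orientation property if $x\bullet y\in\{x,y\}$ for all $x,y\in X$. For groupoids $(X,\ast)$, $(X,\circ)$ on the same set $X$, the product $(X,\ast)\diamond(X,\circ)$ is the groupoid $(X,\cdot)$ with $x\cdot y=(x\ast y)\circ(y\ast x)$ for all $x,y\in X$. Let $X=\{x_1,\dots,x_n\}$ be finite with a fixed enumeration. The orient-factor $O(X,\bullet)=(X,\ast)$ is defined by $x_i\ast x_j=x_j$ if $i+j=n+1$, and $x_i\ast x_j=x_i$ otherwise. The skew-factor $J(X,\bullet)=(X,\circ)$ is defined by $x_i\circ x_j=x_j\bullet x_i$ if $i+j=n+1$, and $x_i\circ x_j=x_i\bullet x_j$ otherwise. A groupoid $(X,\bullet)$ is $j$-normal if both $(X,\bullet)=O(X,\bullet)\diamond J(X,\bullet)$ and $(X,\bullet)=J(X,\bullet)\diamond O(X,\bullet)$. *)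

theory Defs imports Main begin

record 'a groupoid =
  carrier :: "'a set"
  mult :: "'a \<Rightarrow> 'a \<Rightarrow> 'a" (infixl "\<bullet>\<index>" 70)

definition is_groupoid :: "'a groupoid \<Rightarrow> bool" where
  "is_groupoid G \<longleftrightarrow>
     carrier G \<noteq> {} \<and> (\<forall>a\<in>carrier G. \<forall>b\<in>carrier G. a \<bullet>\<^bsub>G\<^esub> b \<in> carrier G)"

text \<open>
  The field \<open>mult\<close> is a total function on the type, whose values outside the carrier carry no
  meaning. Equality of groupoids therefore compares the operations on the carrier only.
\<close>
definition groupoid_eq :: "'a groupoid \<Rightarrow> 'a groupoid \<Rightarrow> bool" (infix "\<doteq>" 50) where
  "G \<doteq> H \<longleftrightarrow>
     carrier G = carrier H \<and>
     (\<forall>a\<in>carrier G. \<forall>b\<in>carrier G. a \<bullet>\<^bsub>G\<^esub> b = a \<bullet>\<^bsub>H\<^esub> b)"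

definition orientation_property :: "'a groupoid \<Rightarrow> bool" where
  "orientation_property G \<longleftrightarrow> (\<forall>a\<in>carrier G. \<forall>b\<in>carrier G. a \<bullet>\<^bsub>G\<^esub> b \<in> {a, b})"

text \<open>The product is meant for two groupoids with the same carrier.\<close>
definition groupoid_prod :: "'a groupoid \<Rightarrow> 'a groupoid \<Rightarrow> 'a groupoid" (infixl "\<diamond>" 65) where
  "G \<diamond> H =
     \<lparr>carrier = carrier G, mult = (\<lambda>a b. (a \<bullet>\<^bsub>G\<^esub> b) \<bullet>\<^bsub>H\<^esub> (b \<bullet>\<^bsub>G\<^esub> a))\<rparr>"

text \<open>
  An enumeration \<open>x\<^sub>1, \<dots>, x\<^sub>n\<close> of a set \<open>X\<close> is a bijection \<open>x\<close> from \<open>{1..n}\<close> to \<open>X\<close>. The factors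
  below are defined on elements through the index an element has in the enumeration.
\<close>
definition enumeration :: "nat \<Rightarrow> (nat \<Rightarrow> 'a) \<Rightarrow> 'a set \<Rightarrow> bool" where
  "enumeration n x X \<longleftrightarrow> bij_betw x {1..n} X"

definition index_of :: "nat \<Rightarrow> (nat \<Rightarrow> 'a) \<Rightarrow> 'a \<Rightarrow> nat" where
  "index_of n x a = inv_into {1..n} x a"

definition orient_factor :: "nat \<Rightarrow> (nat \<Rightarrow> 'a) \<Rightarrow> 'a groupoid \<Rightarrow> 'a groupoid" where
  "orient_factor n x G =
     \<lparr>carrier = carrier G,
      mult = (\<lambda>a b. if index_of n x a + index_of n x b = n + 1 then b else a)\<rparr>"

definition skew_factor :: "nat \<Rightarrow> (nat \<Rightarrow> 'a) \<Rightarrow> 'a groupoid \<Rightarrow> 'a groupoid" where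
  "skew_factor n x G =
     \<lparr>carrier = carrier G,
      mult = (\<lambda>a b. if index_of n x a + index_of n x b = n + 1 then b \<bullet>\<^bsub>G\<^esub> a else a \<bullet>\<^bsub>G\<^esub> b)\<rparr>"

definition j_normal :: "nat \<Rightarrow> (nat \<Rightarrow> 'a) \<Rightarrow> 'a groupoid \<Rightarrow> bool" where
  "j_normal n x G \<longleftrightarrow>
     G \<doteq> orient_factor n x G \<diamond> skew_factor n x G \<and>
     G \<doteq> skew_factor n x G \<diamond> orient_factor n x G"

lemma index_of_enumeration:
  assumes "enumeration n x X" and "i \<in> {1..n}"
  shows "index_of n x (x i) = i"
  using assms by (auto simp: enumeration_def index_of_def bij_betw_def)

lemma orient_factor_enumeration:
  assumes "enumeration n x (carrier G)" and "i \<in> {1..n}" and "j \<in> {1..n}"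
  shows "x i \<bullet>\<^bsub>orient_factor n x G\<^esub> x j = (if i + j = n + 1 then x j else x i)"
  using assms by (simp add: orient_factor_def index_of_enumeration)

lemma skew_factor_enumeration:
  assumes "enumeration n x (carrier G)" and "i \<in> {1..n}" and "j \<in> {1..n}"
  shows "x i \<bullet>\<^bsub>skew_factor n x G\<^esub> x j =
           (if i + j = n + 1 then x j \<bullet>\<^bsub>G\<^esub> x i else x i \<bullet>\<^bsub>G\<^esub> x j)"
  using assms by (simp add: skew_factor_def index_of_enumeration)

lemma is_groupoid_factors:
  assumes "is_groupoid G"
  shows "is_groupoid (orient_factor n x G)" and "is_groupoid (skew_factor n x G)"
  using assms by (auto simp: is_groupoid_def orient_factor_def skew_factor_def)

end

theory Submission imports Defs begin

text \<open>Whether two indices sum to \<open>n + 1\<close> is symmetric in \<open>a\<close> and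
  \<open>b\<close>. If they do, each factor reverses its arguments and the two reversals cancel;
  otherwise neither does.\<close>

lemma orient_diamond_skew: "G \<doteq> orient_factor n x G \<diamond> skew_factor n x G"
  by (simp add: groupoid_eq_def groupoid_prod_def orient_factor_def skew_factor_def add.commute)

lemma skew_diamond_orient:
  assumes "orientation_property G"
  shows "G \<doteq> skew_factor n x G \<diamond> orient_factor n x G"
proof -
  have "a \<bullet>\<^bsub>G\<^esub> b = a \<bullet>\<^bsub>skew_factor n x G \<diamond> orient_factor n x G\<^esub> b"
    if "a \<in> carrier G" "b \<in> carrier G" for a b
  proof -
    have "a \<bullet>\<^bsub>G\<^esub> b = a \<or> a \<bullet>\<^bsub>G\<^esub> b = b" "b \<bullet>\<^bsub>G\<^esub> a = a \<or> b \<bullet>\<^bsub>G\<^esub> a = b"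
      using assms that by (auto simp: orientation_property_def)
    then show ?thesis
      \<comment> \<open>When both products coincide, either branch of the orient-factor returns the
        common value.\<close>
      by (auto simp: groupoid_prod_def orient_factor_def skew_factor_def add.commute)
  qed
  then show ?thesis
    by (simp add: groupoid_eq_def groupoid_prod_def skew_factor_def)
qed

theorem proposition4p2p5:
  fixes G :: "'a groupoid" and n :: nat and x :: "nat \<Rightarrow> 'a"
  assumes "n \<ge> 1"
    and "enumeration n x (carrier G)"
    and "is_groupoid G"
    and "orientation_property G"
  shows "j_normal n x G"
  using assms(4) by (simp add: j_normal_def orient_diamond_skew skew_diamond_orient)

end
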